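(* Let $A(\mu)\in\mathbb{C}^{n\times n}$ be an analytic matrix-valued function of $\mu\in\mathbb{C}$ with $A(0)$ nonsingular, let $b\in\mathbb{C}^n$, and let $N\ge 1$ be an integer. Let $\mathbf{B}_N\in\mathbb{C}^{(N+1)n\times(N+1)n}$, $c\in\mathbb{C}^{(N+1)n}$ and $A_N(\mu)$ be defined from $A$, $b$ and $N$ as in the context. For any $\mu\in\mathbb{C}\setminus\{0\}$, consider the linear system $$(\mu\mathbf{B}_N-I)\,v(\mu)=c,\qquad v(\mu)=[v_0(\mu)^T,\ldots,v_N(\mu)^T]^T\in\mathbb{C}^{(N+1)n},\quad v_i(\mu)\in\mathbb{C}^n, \qquad (\mathrm{L})$$ and the linear system $$A_N(\mu)\,x_N(\mu)=b,\qquad x_N(\mu)\in\mathbb{C}^n. \qquad (\mathrm{P})$$ Then (L) and (P) are equivalent in the following sense: (a) Every solution $v(\mu)$ of (L) is of the form $v_i(\mu)=\frac{\mu^i}{i!}x_N(\mu)$, $i=0,\ldots,N$, where $x_N(\mu)\in\mathbb{C}^n$ satisfies (P). (b) If $x_N(\mu)\in\mathbb{C}^n$ is a solution of (P), then the vector $v(\mu)$ with blocks $v_i(\mu):=\frac{\mu^i}{i!}x_N(\mu)$, $i=0,\ldots,N$, is a solution of (L).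
   Context: Define $B(\mu):=\frac1\mu A(0)^{-1}\big(A(0)-A(\mu)\big)$ for $\mu \neq 0$ (extended analytically to $\mu=0$). Its truncated Taylor expansion is $B_N(\mu)=\sum_{i=0}^N\frac{1}{i!}B_i\mu^i$ with $B_i=-\frac{1}{i+1}A(0)^{-1}A^{(i+1)}(0)\in\mathbb{C}^{n\times n}$, where $A^{(i)}(0)$ is the $i$-th derivative of $A$ at $0$. The companion matrix is the block matrix (with $n\times n$ blocks, block rows and columns indexed $0,\ldots,N$) $$\mathbf{B}_N=\begin{bmatrix}B_0&B_1&\cdots&B_{N-1}&B_N\\ I&&&&0\\ &\frac12 I&&&\vdots\\ &&\ddots&&\vdots\\ &&&\frac1N I&0\end{bmatrix},$$ i.e. its first block row is $(B_0,\ldots,B_N)$, its block $(i,i-1)$ is $\frac1i I$ for $i=1,\ldots,N$, and all other blocks are zero. The right-hand side is $c=-e_1\otimes A(0)^{-1}b$, i.e. its first block of length $n$ is $-A(0)^{-1}b$ and all other entries are zero. $A_N(\mu)$ is the truncated Taylor expansion of $A$ at $0$ corresponding to $B_N(\mu)$, namely $A_N(\mu)=\sum_{i=0}^{N+1}\frac{1}{i!}A^{(i)}(0)\mu^i$; equivalently, $\mu B_N(\mu)=A(0)^{-1}\big(A(0)-A_N(\mu)\big)$. *)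

theory Defs
  imports
    "HOL-Analysis.Complex_Analysis_Basics"
    "Jordan_Normal_Form.Gauss_Jordan_Elimination"
begin

unbundle no vec_syntax

text \<open>Throughout, \<open>n\<close> is the size of the matrices \<open>A \<mu>\<close>; vectors and matrices are those of
  \<^theory>\<open>Jordan_Normal_Form.Matrix\<close>, with indices starting at 0.\<close>

text \<open>The \<open>k\<close>-th derivative at 0 of a matrix-valued function, taken entrywise.\<close>

definition mat_deriv0 :: "nat \<Rightarrow> (complex \<Rightarrow> complex mat) \<Rightarrow> nat \<Rightarrow> complex mat" where
  "mat_deriv0 n A k = mat n n (\<lambda>(r, s). (deriv ^^ k) (\<lambda>z. A z $$ (r, s)) 0)"

text \<open>Only meaningful for invertible \<open>M\<close>, as \<open>mat_inverse M = None\<close> otherwise; see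
  \<open>inv_mat\<close> below.\<close>

definition inv_mat :: "complex mat \<Rightarrow> complex mat" where
  "inv_mat M = the (mat_inverse M)"

lemma inv_mat:
  assumes M: "M \<in> carrier_mat n n" and inv: "invertible_mat M"
  shows "inv_mat M \<in> carrier_mat n n" "M * inv_mat M = 1\<^sub>m n" "inv_mat M * M = 1\<^sub>m n"
proof -
  obtain X where X: "M * X = 1\<^sub>m n" "X * M = 1\<^sub>m (dim_row X)"
    using M inv unfolding invertible_mat_def inverts_mat_def by auto
  have "dim_col X = n"
    using arg_cong[OF X(1), of dim_col] by simp
  moreover have "dim_row X = n"
    using arg_cong[OF X(2), of dim_col] M by simp
  ultimately have "M \<in> Units (ring_mat TYPE(complex) n ())"
    using M X by (auto simp: Units_def ring_mat_simps)
  then obtain Y where "mat_inverse M = Some Y"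
    using mat_inverse(1)[OF M, of "()"] by fastforce
  then show "inv_mat M \<in> carrier_mat n n" "M * inv_mat M = 1\<^sub>m n" "inv_mat M * M = 1\<^sub>m n"
    using mat_inverse(2)[OF M] unfolding inv_mat_def by auto
qed

definition B_coeff :: "nat \<Rightarrow> (complex \<Rightarrow> complex mat) \<Rightarrow> nat \<Rightarrow> complex mat" where
  "B_coeff n A i = (- (1 / of_nat (i + 1))) \<cdot>\<^sub>m (inv_mat (A 0) * mat_deriv0 n A (i + 1))"

text \<open>The Taylor polynomial of \<open>A\<close> at 0 of degree \<open>N + 1\<close>; the sum of matrices is written
  entrywise.\<close>

definition A_trunc :: "nat \<Rightarrow> (complex \<Rightarrow> complex mat) \<Rightarrow> nat \<Rightarrow> complex \<Rightarrow> complex mat" where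
  "A_trunc n A N \<mu> =
     mat n n (\<lambda>(r, s). \<Sum>i\<le>N + 1. 1 / fact i * mat_deriv0 n A i $$ (r, s) * \<mu> ^ i)"

definition companion_block ::
    "nat \<Rightarrow> (complex \<Rightarrow> complex mat) \<Rightarrow> nat \<Rightarrow> nat \<Rightarrow> complex mat" where
  "companion_block n A i j =
     (if i = 0 then B_coeff n A j
      else if i = j + 1 then (1 / of_nat i) \<cdot>\<^sub>m 1\<^sub>m n
      else 0\<^sub>m n n)"

text \<open>Entry \<open>(p, q)\<close> of a block matrix lies in block \<open>(p div n, q div n)\<close>, at position
  \<open>(p mod n, q mod n)\<close>.\<close>

definition companion_mat :: "nat \<Rightarrow> (complex \<Rightarrow> complex mat) \<Rightarrow> nat \<Rightarrow> complex mat" where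
  "companion_mat n A N =
     mat ((N + 1) * n) ((N + 1) * n)
       (\<lambda>(p, q). companion_block n A (p div n) (q div n) $$ (p mod n, q mod n))"

definition companion_rhs ::
    "nat \<Rightarrow> (complex \<Rightarrow> complex mat) \<Rightarrow> complex vec \<Rightarrow> nat \<Rightarrow> complex vec" where
  "companion_rhs n A b N = (- (inv_mat (A 0) *\<^sub>v b)) @\<^sub>v 0\<^sub>v (N * n)"

definition vec_block :: "nat \<Rightarrow> complex vec \<Rightarrow> nat \<Rightarrow> complex vec" where
  "vec_block n v i = vec n (\<lambda>r. v $ (i * n + r))"

definition stack_vec :: "nat \<Rightarrow> nat \<Rightarrow> (nat \<Rightarrow> complex vec) \<Rightarrow> complex vec" where
  "stack_vec n N w = vec ((N + 1) * n) (\<lambda>p. w (p div n) $ (p mod n))"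

lemma vec_block_stack_vec:
  assumes "i \<le> N" "w i \<in> carrier_vec n"
  shows "vec_block n (stack_vec n N w) i = w i"
proof (rule eq_vecI)
  fix r assume "r < dim_vec (w i)"
  then have r: "r < n" using assms by simp
  have "i * n + r < (i + 1) * n" using r by simp
  also have "\<dots> \<le> (N + 1) * n" using assms by (intro mult_le_mono1) simp
  finally show "vec_block n (stack_vec n N w) i $ r = w i $ r"
    using r by (simp add: vec_block_def stack_vec_def)
qed (use assms in \<open>simp add: vec_block_def\<close>)

definition solves_L ::
    "nat \<Rightarrow> (complex \<Rightarrow> complex mat) \<Rightarrow> complex vec \<Rightarrow> nat \<Rightarrow> complex \<Rightarrow> complex vec \<Rightarrow> bool" where
  "solves_L n A b N \<mu> v \<longleftrightarrow>
     v \<in> carrier_vec ((N + 1) * n) \<and>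
     (\<mu> \<cdot>\<^sub>m companion_mat n A N - 1\<^sub>m ((N + 1) * n)) *\<^sub>v v = companion_rhs n A b N"

definition solves_P ::
    "nat \<Rightarrow> (complex \<Rightarrow> complex mat) \<Rightarrow> complex vec \<Rightarrow> nat \<Rightarrow> complex \<Rightarrow> complex vec \<Rightarrow> bool" where
  "solves_P n A b N \<mu> x \<longleftrightarrow> x \<in> carrier_vec n \<and> A_trunc n A N \<mu> *\<^sub>v x = b"

end

theory Submission
  imports Defs
begin

text \<open>
  The companion matrix acts on block vectors like a shift. Its rows below the first one say
  \<open>v\<^sub>i = (\<mu> / i) v\<^sub>i\<^sub>-\<^sub>1\<close>, so they hold exactly when
  \<open>v\<^sub>i = (\<mu>\<^sup>i / i!) v\<^sub>0\<close> (\<open>companion_recurrence_iff\<close>). The whole vector is thus determined by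
  its first block \<open>x = v\<^sub>0\<close>, and the first block row becomes an equation for \<open>x\<close> alone:
  \<open>(\<mu> B\<^sub>N(\<mu>) - I) x = - A(0)\<^sup>-\<^sup>1 b\<close>, where \<open>B\<^sub>N(\<mu>)\<close> is the sum of the
  \<open>(\<mu>\<^sup>j / j!) B\<^sub>j\<close>.

  By the definition of the \<open>B\<^sub>j\<close>, \<open>\<mu> B\<^sub>N(\<mu>) - I = - A(0)\<^sup>-\<^sup>1 A\<^sub>N(\<mu>)\<close>
  (\<open>inv_mat_mult_A_trunc\<close>): the factor \<open>1 / (j + 1)\<close> in \<open>B\<^sub>j\<close> turns \<open>\<mu>\<^sup>j\<^sup>+\<^sup>1 / j!\<close> into the Taylor
  weight \<open>\<mu>\<^sup>j\<^sup>+\<^sup>1 / (j + 1)!\<close>, and the zeroth Taylor term \<open>A(0)\<close> contributes the identity.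
  Cancelling \<open>A(0)\<^sup>-\<^sup>1\<close> leaves \<open>A\<^sub>N(\<mu>) x = b\<close>. All these steps are equivalences, so both
  directions of the theorem follow from one characterization, \<open>solves_L_iff\<close>.
\<close>

section \<open>Block vectors\<close>

lemma block_index_less:
  fixes i r n N :: nat
  assumes "i \<le> N" "r < n"
  shows "i * n + r < (N + 1) * n"
proof -
  have "i * n + r < (i + 1) * n" using assms by simp
  also have "\<dots> \<le> (N + 1) * n" using assms by (intro mult_le_mono1) simp
  finally show ?thesis .
qed

lemma vec_block_carrier [simp]: "vec_block n v i \<in> carrier_vec n"
  by (simp add: vec_block_def)

lemma dim_vec_block [simp]: "dim_vec (vec_block n v i) = n"
  by (simp add: vec_block_def)

lemma eq_vec_iff_blocks:
  assumes "v \<in> carrier_vec ((N + 1) * n)" "w \<in> carrier_vec ((N + 1) * n)"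
  shows "v = w \<longleftrightarrow> (\<forall>i\<le>N. vec_block n v i = vec_block n w i)"
proof
  assume *: "\<forall>i\<le>N. vec_block n v i = vec_block n w i"
  show "v = w"
  proof (rule eq_vecI)
    fix p assume "p < dim_vec w"
    then have p: "p < (N + 1) * n" using assms by simp
    then have n: "0 < n" by (cases n) auto
    have "p div n < N + 1" using p by (rule less_mult_imp_div_less)
    then have "vec_block n v (p div n) $ (p mod n) = vec_block n w (p div n) $ (p mod n)"
      using * by simp
    then show "v $ p = w $ p" using n by (simp add: vec_block_def)
  qed (use assms in simp)
qed simp

lemma sum_blocks:
  fixes f :: "nat \<Rightarrow> 'a::comm_monoid_add"
  shows "(\<Sum>q<(N + 1) * n. f q) = (\<Sum>j\<le>N. \<Sum>s<n. f (j * n + s))"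
proof -
  have "(\<Sum>q<(N + 1) * n. f q) = (\<Sum>j<N + 1. sum f {j * n..<j * n + n})"
    by (rule sum.nat_group [symmetric])
  also have "\<dots> = (\<Sum>j<N + 1. \<Sum>s<n. f (j * n + s))"
  proof (rule sum.cong [OF refl])
    fix j
    show "sum f {j * n..<j * n + n} = (\<Sum>s<n. f (j * n + s))"
      using sum.shift_bounds_nat_ivl [of f 0 "j * n" n]
      by (simp add: add.commute lessThan_atLeast0)
  qed
  finally show ?thesis by (simp add: lessThan_Suc_atMost)
qed

section \<open>The block rows of the linearized system\<close>

lemma B_coeff_carrier:
  assumes "inv_mat (A 0) \<in> carrier_mat n n"
  shows "B_coeff n A j \<in> carrier_mat n n"
  using assms by (simp add: B_coeff_def mat_deriv0_def)

lemma companion_mat_mult_index: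
  assumes v: "v \<in> carrier_vec ((N + 1) * n)" and i: "i \<le> N" and r: "r < n"
  shows "(companion_mat n A N *\<^sub>v v) $ (i * n + r)
           = (\<Sum>j\<le>N. \<Sum>s<n. companion_block n A i j $$ (r, s) * vec_block n v j $ s)"
proof -
  have p: "i * n + r < (N + 1) * n" by (rule block_index_less [OF i r])
  have "(companion_mat n A N *\<^sub>v v) $ (i * n + r)
          = (\<Sum>q<(N + 1) * n. companion_block n A i (q div n) $$ (r, q mod n) * v $ q)"
    using v r p by (simp add: companion_mat_def scalar_prod_def lessThan_atLeast0)
  also have "\<dots> = (\<Sum>j\<le>N. \<Sum>s<n. companion_block n A i j $$ (r, s) * vec_block n v j $ s)"
    unfolding sum_blocks by (intro sum.cong refl) (simp add: vec_block_def)
  finally show ?thesis .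
qed

lemma companion_mat_mult_first_block:
  assumes v: "v \<in> carrier_vec ((N + 1) * n)" and r: "r < n"
    and J: "inv_mat (A 0) \<in> carrier_mat n n"
  shows "(companion_mat n A N *\<^sub>v v) $ r = (\<Sum>j\<le>N. (B_coeff n A j *\<^sub>v vec_block n v j) $ r)"
proof -
  have "(B_coeff n A j *\<^sub>v vec_block n v j) $ r
          = (\<Sum>s<n. B_coeff n A j $$ (r, s) * vec_block n v j $ s)" for j
    using B_coeff_carrier [where A = A and j = j, OF J] r
    by (simp add: scalar_prod_def lessThan_atLeast0)
  then show ?thesis
    using companion_mat_mult_index [OF v le0 r, of A] by (simp add: companion_block_def)
qed

lemma companion_mat_mult_lower_block:
  assumes v: "v \<in> carrier_vec ((N + 1) * n)" and i: "Suc i \<le> N" and r: "r < n"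
  shows "(companion_mat n A N *\<^sub>v v) $ (Suc i * n + r) = vec_block n v i $ r / of_nat (Suc i)"
proof -
  have "(\<Sum>s<n. companion_block n A (Suc i) j $$ (r, s) * vec_block n v j $ s)
          = (if j = i then vec_block n v i $ r / of_nat (Suc i) else 0)" for j
  proof -
    have "(\<Sum>s<n. companion_block n A (Suc i) j $$ (r, s) * vec_block n v j $ s)
            = (\<Sum>s<n. if s = r then (if j = i then vec_block n v i $ r / of_nat (Suc i) else 0) else 0)"
      using r by (intro sum.cong refl) (auto simp: companion_block_def)
    then show ?thesis using r by simp
  qed
  then show ?thesis
    using i by (simp only: companion_mat_mult_index [OF v i r]) simp
qed

text \<open>Only the first block row couples all blocks and carries the right-hand side. The others
  are homogeneous and link neighbouring blocks, which is why they can be written as a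
  first-order recurrence.\<close>

lemma solves_L_iff_block_rows:
  assumes J: "inv_mat (A 0) \<in> carrier_mat n n"
  shows "solves_L n A b N \<mu> v \<longleftrightarrow>
           v \<in> carrier_vec ((N + 1) * n) \<and>
           (\<forall>r<n. \<mu> * (\<Sum>j\<le>N. (B_coeff n A j *\<^sub>v vec_block n v j) $ r) - vec_block n v 0 $ r
                     = - (inv_mat (A 0) *\<^sub>v b) $ r) \<and>
           (\<forall>i<N. vec_block n v (Suc i) = (\<mu> / of_nat (Suc i)) \<cdot>\<^sub>v vec_block n v i)"
proof (cases "v \<in> carrier_vec ((N + 1) * n)")
  case v: True
  define C where "C = companion_mat n A N"
  define w where "w = (\<mu> \<cdot>\<^sub>m C - 1\<^sub>m ((N + 1) * n)) *\<^sub>v v"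
  define c where "c = companion_rhs n A b N"
  have C: "C \<in> carrier_mat ((N + 1) * n) ((N + 1) * n)"
    by (simp add: C_def companion_mat_def)
  have w: "w \<in> carrier_vec ((N + 1) * n)"
    unfolding w_def by (rule carrier_vecI) simp
  have c: "c \<in> carrier_vec ((N + 1) * n)"
    unfolding c_def companion_rhs_def using J by (intro carrier_vecI) simp
  have w_index: "w $ p = \<mu> * (C *\<^sub>v v) $ p - v $ p" if "p < (N + 1) * n" for p
  proof -
    have "w = (\<mu> \<cdot>\<^sub>m C) *\<^sub>v v - 1\<^sub>m ((N + 1) * n) *\<^sub>v v"
      unfolding w_def using C v by (intro minus_mult_distrib_mat_vec) auto
    also have "\<dots> $ p = (\<mu> \<cdot>\<^sub>m C *\<^sub>v v) $ p - v $ p"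
      using that C v by (simp del: index_mult_mat_vec)
    also have "(\<mu> \<cdot>\<^sub>m C *\<^sub>v v) $ p = \<mu> * (C *\<^sub>v v) $ p"
      using that C v by (simp add: scalar_prod_def sum_distrib_left mult.assoc)
    finally show ?thesis .
  qed
  have c_index: "c $ (i * n + r) = (if i = 0 then - (inv_mat (A 0) *\<^sub>v b) $ r else 0)"
    if "i \<le> N" "r < n" for i r
    using block_index_less [OF that] that J
    by (cases i) (auto simp: c_def companion_rhs_def)
  have first: "vec_block n w 0 = vec_block n c 0 \<longleftrightarrow>
      (\<forall>r<n. \<mu> * (\<Sum>j\<le>N. (B_coeff n A j *\<^sub>v vec_block n v j) $ r) - vec_block n v 0 $ r
                     = - (inv_mat (A 0) *\<^sub>v b) $ r)"
  proof -
    have "vec_block n w 0 $ r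
            = \<mu> * (\<Sum>j\<le>N. (B_coeff n A j *\<^sub>v vec_block n v j) $ r) - vec_block n v 0 $ r"
      if r: "r < n" for r
      using r w_index [of r] companion_mat_mult_first_block [where A = A, OF v r J]
      by (simp add: vec_block_def C_def)
    moreover have "vec_block n c 0 $ r = - (inv_mat (A 0) *\<^sub>v b) $ r" if r: "r < n" for r
      using c_index [OF le0 r] r by (simp add: vec_block_def)
    ultimately show ?thesis by (simp add: vec_eq_iff)
  qed
  have lower: "vec_block n w (Suc i) = vec_block n c (Suc i) \<longleftrightarrow>
      vec_block n v (Suc i) = (\<mu> / of_nat (Suc i)) \<cdot>\<^sub>v vec_block n v i" if i: "Suc i \<le> N" for i
  proof -
    have "vec_block n w (Suc i) $ r
            = \<mu> / of_nat (Suc i) * vec_block n v i $ r - vec_block n v (Suc i) $ r"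
      if r: "r < n" for r
      using r w_index [OF block_index_less [OF i r]] companion_mat_mult_lower_block [OF v i r, of A]
      by (simp add: vec_block_def C_def)
    moreover have "vec_block n c (Suc i) $ r = 0" if r: "r < n" for r
      using c_index [OF i r] r by (simp add: vec_block_def)
    ultimately show ?thesis by (auto simp: vec_eq_iff)
  qed
  have "solves_L n A b N \<mu> v \<longleftrightarrow> w = c"
    using v by (simp add: solves_L_def w_def c_def C_def)
  also have "\<dots> \<longleftrightarrow> vec_block n w 0 = vec_block n c 0 \<and>
                     (\<forall>i<N. vec_block n w (Suc i) = vec_block n c (Suc i))"
    unfolding eq_vec_iff_blocks [OF w c] by (metis Suc_le_eq le0 not0_implies_Suc)
  also have "(\<forall>i<N. vec_block n w (Suc i) = vec_block n c (Suc i)) \<longleftrightarrow>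
      (\<forall>i<N. vec_block n v (Suc i) = (\<mu> / of_nat (Suc i)) \<cdot>\<^sub>v vec_block n v i)"
    using lower by (meson Suc_leI)
  finally show ?thesis using first v by blast
qed (simp add: solves_L_def)

lemma companion_recurrence_iff:
  fixes w :: "nat \<Rightarrow> complex vec"
  shows "(\<forall>i<N. w (Suc i) = (\<mu> / of_nat (Suc i)) \<cdot>\<^sub>v w i) \<longleftrightarrow>
         (\<forall>i\<le>N. w i = (\<mu> ^ i / fact i) \<cdot>\<^sub>v w 0)"
proof (intro iffI allI impI)
  fix i assume *: "\<forall>i<N. w (Suc i) = (\<mu> / of_nat (Suc i)) \<cdot>\<^sub>v w i" and "i \<le> N"
  from \<open>i \<le> N\<close> show "w i = (\<mu> ^ i / fact i) \<cdot>\<^sub>v w 0"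
  proof (induction i)
    case (Suc i)
    then have "w (Suc i) = (\<mu> / of_nat (Suc i)) \<cdot>\<^sub>v ((\<mu> ^ i / fact i) \<cdot>\<^sub>v w 0)"
      using * by (metis Suc_leD Suc_le_lessD)
    then show ?case by (simp add: smult_smult_assoc)
  qed simp
next
  fix i assume *: "\<forall>i\<le>N. w i = (\<mu> ^ i / fact i) \<cdot>\<^sub>v w 0" and "i < N"
  then have "w (Suc i) = (\<mu> ^ Suc i / fact (Suc i)) \<cdot>\<^sub>v w 0"
    by (blast intro: Suc_leI)
  also have "\<dots> = (\<mu> / of_nat (Suc i)) \<cdot>\<^sub>v ((\<mu> ^ i / fact i) \<cdot>\<^sub>v w 0)"
    by (simp add: smult_smult_assoc)
  also have "(\<mu> ^ i / fact i) \<cdot>\<^sub>v w 0 = w i"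
    using * \<open>i < N\<close> by (metis less_imp_le)
  finally show "w (Suc i) = (\<mu> / of_nat (Suc i)) \<cdot>\<^sub>v w i" .
qed

section \<open>The first block row and the truncated Taylor expansion\<close>

lemma mat_deriv0_0:
  assumes "A 0 \<in> carrier_mat n n"
  shows "mat_deriv0 n A 0 = A 0"
  using assms by (intro eq_matI) (auto simp: mat_deriv0_def)

text \<open>This is \<open>\<mu> B\<^sub>N(\<mu>) = A(0)\<^sup>-\<^sup>1 (A(0) - A\<^sub>N(\<mu>))\<close> with \<open>A(0)\<^sup>-\<^sup>1 A(0) = I\<close>. It holds term by
  term in powers of \<open>\<mu>\<close>: splitting off the constant term of \<open>A\<^sub>N\<close> leaves the powers
  \<open>\<mu>\<^sup>j\<^sup>+\<^sup>1\<close> with \<open>j \<le> N\<close>, matched by \<open>(j + 1)! = (j + 1) j!\<close>. It is read entrywise because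
  \<^const>\<open>A_trunc\<close> is a matrix of sums.\<close>

lemma inv_mat_mult_A_trunc:
  assumes A0: "A 0 \<in> carrier_mat n n" and inv: "invertible_mat (A 0)"
    and r: "r < n" and s: "s < n"
  shows "(inv_mat (A 0) * A_trunc n A N \<mu>) $$ (r, s)
           = 1\<^sub>m n $$ (r, s) - \<mu> * (\<Sum>j\<le>N. \<mu> ^ j / fact j * B_coeff n A j $$ (r, s))"
proof -
  define J where "J = inv_mat (A 0)"
  define D where "D = mat_deriv0 n A"
  have J: "J \<in> carrier_mat n n" "J * A 0 = 1\<^sub>m n"
    using inv_mat [OF A0 inv] by (simp_all add: J_def)
  have D: "D i \<in> carrier_mat n n" for i by (simp add: D_def mat_deriv0_def)
  have JD: "(J * D i) $$ (r, s) = (\<Sum>t<n. J $$ (r, t) * D i $$ (t, s))" for i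
    using J D [of i] r s by (simp add: scalar_prod_def lessThan_atLeast0)
  have "(J * A_trunc n A N \<mu>) $$ (r, s)
          = (\<Sum>t<n. J $$ (r, t) * (\<Sum>i\<le>N + 1. 1 / fact i * D i $$ (t, s) * \<mu> ^ i))"
    using J r s by (simp add: A_trunc_def D_def scalar_prod_def lessThan_atLeast0)
  also have "\<dots> = (\<Sum>t<n. \<Sum>i\<le>N + 1. \<mu> ^ i / fact i * (J $$ (r, t) * D i $$ (t, s)))"
    unfolding sum_distrib_left by (intro sum.cong refl) (simp add: field_simps)
  also have "\<dots> = (\<Sum>i\<le>N + 1. \<mu> ^ i / fact i * (J * D i) $$ (r, s))"
    unfolding JD sum_distrib_left by (rule sum.swap)
  also have "\<dots> = (J * D 0) $$ (r, s)
                     + (\<Sum>j\<le>N. \<mu> ^ Suc j / fact (Suc j) * (J * D (Suc j)) $$ (r, s))"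
    unfolding Suc_eq_plus1 [symmetric] sum.atMost_Suc_shift by simp
  also have "(J * D 0) $$ (r, s) = 1\<^sub>m n $$ (r, s)"
    using J mat_deriv0_0 [where A = A, OF A0] by (simp add: D_def)
  also have "(\<Sum>j\<le>N. \<mu> ^ Suc j / fact (Suc j) * (J * D (Suc j)) $$ (r, s))
               = (\<Sum>j\<le>N. - (\<mu> * (\<mu> ^ j / fact j * B_coeff n A j $$ (r, s))))"
  proof (intro sum.cong refl)
    fix j
    have "B_coeff n A j $$ (r, s) = - (J * D (Suc j)) $$ (r, s) / of_nat (Suc j)"
      using J D [of "Suc j"] r s by (simp add: B_coeff_def J_def D_def)
    then show "\<mu> ^ Suc j / fact (Suc j) * (J * D (Suc j)) $$ (r, s)
                 = - (\<mu> * (\<mu> ^ j / fact j * B_coeff n A j $$ (r, s)))"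
      by (simp add: mult_ac)
  qed
  finally show ?thesis
    by (simp add: J_def sum_negf sum_distrib_left)
qed

lemma first_block_row_eq:
  assumes A0: "A 0 \<in> carrier_mat n n" and inv: "invertible_mat (A 0)"
    and x: "x \<in> carrier_vec n" and r: "r < n"
  shows "\<mu> * (\<Sum>j\<le>N. (B_coeff n A j *\<^sub>v ((\<mu> ^ j / fact j) \<cdot>\<^sub>v x)) $ r) - x $ r
           = - ((inv_mat (A 0) * A_trunc n A N \<mu>) *\<^sub>v x) $ r"
proof -
  define J where "J = inv_mat (A 0)"
  have J: "J \<in> carrier_mat n n" using inv_mat [OF A0 inv] by (simp add: J_def)
  have "(B_coeff n A j *\<^sub>v ((\<mu> ^ j / fact j) \<cdot>\<^sub>v x)) $ r
          = (\<Sum>s<n. \<mu> ^ j / fact j * B_coeff n A j $$ (r, s) * x $ s)" for j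
    using B_coeff_carrier [where A = A and j = j, OF J [unfolded J_def]] r x
    by (simp add: scalar_prod_def lessThan_atLeast0 mult_ac)
  then have row: "(\<Sum>j\<le>N. (B_coeff n A j *\<^sub>v ((\<mu> ^ j / fact j) \<cdot>\<^sub>v x)) $ r)
      = (\<Sum>s<n. (\<Sum>j\<le>N. \<mu> ^ j / fact j * B_coeff n A j $$ (r, s)) * x $ s)"
    unfolding sum_distrib_right by (simp only:) (rule sum.swap)
  have one: "x $ r = (\<Sum>s<n. 1\<^sub>m n $$ (r, s) * x $ s)"
  proof -
    have "(\<Sum>s<n. 1\<^sub>m n $$ (r, s) * x $ s) = (\<Sum>s<n. if s = r then x $ r else 0)"
      using r by (intro sum.cong refl) auto
    then show ?thesis using r by simp
  qed
  have "((J * A_trunc n A N \<mu>) *\<^sub>v x) $ r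
          = (\<Sum>s<n. (J * A_trunc n A N \<mu>) $$ (r, s) * x $ s)"
    using J r x by (simp add: A_trunc_def scalar_prod_def lessThan_atLeast0)
  also have "\<dots> = (\<Sum>s<n. 1\<^sub>m n $$ (r, s) * x $ s
               - \<mu> * ((\<Sum>j\<le>N. \<mu> ^ j / fact j * B_coeff n A j $$ (r, s)) * x $ s))"
    unfolding J_def
    by (intro sum.cong refl)
       (simp only: inv_mat_mult_A_trunc [where A = A, OF A0 inv r] lessThan_iff
          left_diff_distrib mult.assoc)
  also have "\<dots> = x $ r - \<mu> * (\<Sum>j\<le>N. (B_coeff n A j *\<^sub>v ((\<mu> ^ j / fact j) \<cdot>\<^sub>v x)) $ r)"
    by (simp only: sum_subtractf row one sum_distrib_left)
  finally show ?thesis by (simp add: J_def)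
qed

lemma inv_mat_mult_vec_cancel:
  assumes M: "M \<in> carrier_mat n n" and inv: "invertible_mat M"
    and y: "y \<in> carrier_vec n" and z: "z \<in> carrier_vec n"
  shows "inv_mat M *\<^sub>v y = inv_mat M *\<^sub>v z \<longleftrightarrow> y = z"
proof
  assume "inv_mat M *\<^sub>v y = inv_mat M *\<^sub>v z"
  then have "(M * inv_mat M) *\<^sub>v y = (M * inv_mat M) *\<^sub>v z"
    by (simp only: assoc_mult_mat_vec [OF M inv_mat(1) [OF M inv]] y z)
  then show "y = z"
    using y z by (simp add: inv_mat(2) [OF M inv])
qed simp

section \<open>Equivalence of the two systems\<close>

text \<open>Here the first block \<open>v\<^sub>0\<close> plays the part of \<open>x\<close>, since \<open>\<mu>\<^sup>0 / 0! = 1\<close>. Stated as an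
  equivalence, this gives both directions of the theorem at once.\<close>

lemma solves_L_iff:
  assumes A0: "A 0 \<in> carrier_mat n n" and inv: "invertible_mat (A 0)"
    and b: "b \<in> carrier_vec n"
  shows "solves_L n A b N \<mu> v \<longleftrightarrow>
           v \<in> carrier_vec ((N + 1) * n) \<and>
           solves_P n A b N \<mu> (vec_block n v 0) \<and>
           (\<forall>i\<le>N. vec_block n v i = (\<mu> ^ i / fact i) \<cdot>\<^sub>v vec_block n v 0)"
proof -
  define J where "J = inv_mat (A 0)"
  define T where "T = A_trunc n A N \<mu>"
  define x where "x = vec_block n v 0"
  have J: "J \<in> carrier_mat n n" using inv_mat [OF A0 inv] by (simp add: J_def)
  have T: "T \<in> carrier_mat n n" by (simp add: T_def A_trunc_def)
  have x: "x \<in> carrier_vec n" by (simp add: x_def)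
  have first: "(\<forall>r<n. \<mu> * (\<Sum>j\<le>N. (B_coeff n A j *\<^sub>v vec_block n v j) $ r) - x $ r
                     = - (J *\<^sub>v b) $ r) \<longleftrightarrow> solves_P n A b N \<mu> x"
    if geo: "\<forall>i\<le>N. vec_block n v i = (\<mu> ^ i / fact i) \<cdot>\<^sub>v x"
  proof -
    have "\<mu> * (\<Sum>j\<le>N. (B_coeff n A j *\<^sub>v vec_block n v j) $ r) - x $ r
            = - (J *\<^sub>v (T *\<^sub>v x)) $ r" if r: "r < n" for r
    proof -
      have "(\<Sum>j\<le>N. (B_coeff n A j *\<^sub>v vec_block n v j) $ r)
              = (\<Sum>j\<le>N. (B_coeff n A j *\<^sub>v ((\<mu> ^ j / fact j) \<cdot>\<^sub>v x)) $ r)"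
        using geo by (intro sum.cong refl) simp
      then show ?thesis
        using first_block_row_eq [where A = A and N = N and \<mu> = \<mu>, OF A0 inv x r]
        by (simp only: J_def [symmetric] T_def [symmetric] assoc_mult_mat_vec [OF J T x])
    qed
    then have "\<mu> * (\<Sum>j\<le>N. (B_coeff n A j *\<^sub>v vec_block n v j) $ r) - x $ r
                  = - (J *\<^sub>v b) $ r \<longleftrightarrow> (J *\<^sub>v (T *\<^sub>v x)) $ r = (J *\<^sub>v b) $ r" if "r < n" for r
      using that by (simp only: neg_equal_iff_equal)
    then have "(\<forall>r<n. \<mu> * (\<Sum>j\<le>N. (B_coeff n A j *\<^sub>v vec_block n v j) $ r) - x $ r
                  = - (J *\<^sub>v b) $ r) \<longleftrightarrow> (\<forall>r<n. (J *\<^sub>v (T *\<^sub>v x)) $ r = (J *\<^sub>v b) $ r)"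
      by blast
    also have "\<dots> \<longleftrightarrow> J *\<^sub>v (T *\<^sub>v x) = J *\<^sub>v b"
      using J by (simp add: vec_eq_iff del: index_mult_mat_vec)
    also have "\<dots> \<longleftrightarrow> T *\<^sub>v x = b"
      unfolding J_def using T x by (intro inv_mat_mult_vec_cancel [OF A0 inv _ b]) simp
    finally show ?thesis using x by (simp add: solves_P_def T_def)
  qed
  have "solves_L n A b N \<mu> v \<longleftrightarrow>
           v \<in> carrier_vec ((N + 1) * n) \<and>
           (\<forall>r<n. \<mu> * (\<Sum>j\<le>N. (B_coeff n A j *\<^sub>v vec_block n v j) $ r) - x $ r
                     = - (J *\<^sub>v b) $ r) \<and>
           (\<forall>i\<le>N. vec_block n v i = (\<mu> ^ i / fact i) \<cdot>\<^sub>v x)"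
    unfolding solves_L_iff_block_rows [where A = A, OF J [unfolded J_def]] companion_recurrence_iff
      J_def x_def ..
  then show ?thesis using first unfolding x_def by blast
qed

theorem theorem2p1:
  fixes A :: "complex \<Rightarrow> complex mat" and b :: "complex vec" and n N :: nat and \<mu> :: complex
  assumes A_carrier: "\<And>z. A z \<in> carrier_mat n n"
    and A_analytic: "\<And>r s. r < n \<Longrightarrow> s < n \<Longrightarrow> (\<lambda>z. A z $$ (r, s)) analytic_on UNIV"
    and A0_nonsingular: "invertible_mat (A 0)"
    and b_carrier: "b \<in> carrier_vec n"
    and N_ge_1: "N \<ge> 1"
    and mu_nonzero: "\<mu> \<noteq> 0"
  shows "(\<forall>v. solves_L n A b N \<mu> v \<longrightarrow>
            (\<exists>x. solves_P n A b N \<mu> x \<and>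
                 (\<forall>i\<le>N. vec_block n v i = (\<mu> ^ i / fact i) \<cdot>\<^sub>v x))) \<and>
         (\<forall>x. solves_P n A b N \<mu> x \<longrightarrow>
            solves_L n A b N \<mu> (stack_vec n N (\<lambda>i. (\<mu> ^ i / fact i) \<cdot>\<^sub>v x)))"
proof (intro conjI allI impI)
  have A0: "A 0 \<in> carrier_mat n n" by (rule A_carrier)
  \<comment> \<open>\<open>A 0\<close> unifies with the carrier assumption in several ways, hence the explicit instance.\<close>
  note L_iff = solves_L_iff [where A = A and N = N and \<mu> = \<mu>, OF A0 A0_nonsingular b_carrier]
  {
    fix v assume "solves_L n A b N \<mu> v"
    then show "\<exists>x. solves_P n A b N \<mu> x \<and>
                 (\<forall>i\<le>N. vec_block n v i = (\<mu> ^ i / fact i) \<cdot>\<^sub>v x)"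
      unfolding L_iff by blast
  next
    fix x assume P: "solves_P n A b N \<mu> x"
    define v where "v = stack_vec n N (\<lambda>i. (\<mu> ^ i / fact i) \<cdot>\<^sub>v x)"
    have x: "x \<in> carrier_vec n" using P by (simp add: solves_P_def)
    have blocks: "vec_block n v i = (\<mu> ^ i / fact i) \<cdot>\<^sub>v x" if "i \<le> N" for i
      unfolding v_def using that x by (intro vec_block_stack_vec) auto
    then have "vec_block n v 0 = x" by simp
    moreover have "v \<in> carrier_vec ((N + 1) * n)" by (simp add: v_def stack_vec_def)
    ultimately show "solves_L n A b N \<mu> (stack_vec n N (\<lambda>i. (\<mu> ^ i / fact i) \<cdot>\<^sub>v x))"
      using P blocks unfolding v_def [symmetric] L_iff by simp
  }
qed

end
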